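(* Let $U$ be an ultrafilter on a set $X$ and $W$ an ultrafilter on a set $Y$. Suppose that for all infinite cardinals $\lambda$, either $U$ or $W$ is $(\lambda,2^\lambda)$-indecomposable. Then $U\times W$ is an ultrafilter on $X\times Y$.
   Context: The Cartesian product $U\times W$ is the filter on $X\times Y$ generated by the sets $A\times B$ with $A\in U$, $B\in W$. For cardinals $\lambda\leq\eta$, an ultrafilter $U$ is $(\lambda,\eta)$-indecomposable if for every family of sets $\mathcal P$ of cardinality at most $\eta$ with $\bigcup\mathcal P\in U$, there is some $\mathcal Q\subseteq\mathcal P$ of cardinality less than $\lambda$ such that $\bigcup\mathcal Q\in U$. *)

theory Defs
  imports Main
begin

unbundle cardinal_syntax

text \<open>
  A filter on a set \<open>X\<close> is represented by a library filter that contains \<open>X\<close>;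
  \<open>A \<in> U\<close> is rendered as \<^term>\<open>eventually (\<lambda>x. x \<in> A) U\<close>. The product of two such
  filters is the library's \<^const>\<open>prod_filter\<close>, which is by definition the filter
  generated by the rectangles. Library filters may be improper, hence the first conjunct.
\<close>

definition ultrafilter_on :: "'a set \<Rightarrow> 'a filter \<Rightarrow> bool" where
  "ultrafilter_on X U \<longleftrightarrow>
     U \<noteq> bot \<and> eventually (\<lambda>x. x \<in> X) U \<and>
     (\<forall>A\<subseteq>X. eventually (\<lambda>x. x \<in> A) U \<or> eventually (\<lambda>x. x \<in> X - A) U)"

text \<open>Cardinals are represented by cardinal orders (\<^const>\<open>Card_order\<close>) on arbitrary types.\<close>

definition indecomposable_on ::
    "'a set \<Rightarrow> 'a filter \<Rightarrow> 'c rel \<Rightarrow> 'd rel \<Rightarrow> bool" where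
  "indecomposable_on X U \<kappa> \<eta> \<longleftrightarrow>
     (\<forall>P. P \<subseteq> Pow X \<and> |P| \<le>o \<eta> \<and> eventually (\<lambda>x. x \<in> \<Union>P) U \<longrightarrow>
        (\<exists>Q. Q \<subseteq> P \<and> |Q| <o \<kappa> \<and> eventually (\<lambda>x. x \<in> \<Union>Q) U))"

text \<open>
  HOL cannot quantify over types inside a hypothesis, so a quantifier over all infinite
  cardinals has to range over the cardinal orders on one fixed type. For \<open>X :: 'a set\<close> and
  \<open>Y :: 'b set\<close> the type \<open>'a + 'b\<close> suffices. The lemma
  \<open>indecomposable_all_cardinals\<close> below shows that nothing is lost: the
  condition for the cardinals on that type implies it for the cardinals on every type.
\<close>

lemma indecomposable_on_large:
  assumes "|X| <o \<kappa>"
  shows "indecomposable_on X U \<kappa> \<eta>"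
  unfolding indecomposable_on_def
proof (intro allI impI, elim conjE)
  fix P assume P: "P \<subseteq> Pow X" and ev: "eventually (\<lambda>x. x \<in> \<Union>P) U"
  define f where "f x = (SOME A. A \<in> P \<and> x \<in> A)" for x
  have f: "f x \<in> P \<and> x \<in> f x" if "x \<in> \<Union>P" for x
    unfolding f_def using that by (metis (mono_tags, lifting) UnionE someI)
  have "|f ` \<Union>P| \<le>o |\<Union>P|" by (rule card_of_image)
  moreover have "|\<Union>P| \<le>o |X|" using P by (intro card_of_mono1) auto
  ultimately have "|f ` \<Union>P| <o \<kappa>"
    using assms ordLeq_ordLess_trans ordLeq_transitive by blast
  moreover have "\<Union>(f ` \<Union>P) = \<Union>P" using f by blast
  moreover have "f ` \<Union>P \<subseteq> P" using f by blast
  ultimately show "\<exists>Q. Q \<subseteq> P \<and> |Q| <o \<kappa> \<and> eventually (\<lambda>x. x \<in> \<Union>Q) U"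
    using ev by metis
qed

lemma indecomposable_on_cong:
  assumes "indecomposable_on X U \<kappa> \<eta>" "\<kappa> =o \<kappa>'" "\<eta> =o \<eta>'"
  shows "indecomposable_on X U \<kappa>' \<eta>'"
  using assms unfolding indecomposable_on_def
  by (meson ordIso_symmetric ordLeq_ordIso_trans ordLess_ordIso_trans)

lemma indecomposable_all_cardinals:
  fixes X :: "'a set" and Y :: "'b set" and \<mu> :: "'c rel"
  assumes all: "\<And>\<kappa> :: ('a + 'b) rel. Cinfinite \<kappa> \<Longrightarrow>
      indecomposable_on X U \<kappa> (ctwo ^c \<kappa>) \<or> indecomposable_on Y W \<kappa> (ctwo ^c \<kappa>)"
    and \<mu>: "Cinfinite \<mu>"
  shows "indecomposable_on X U \<mu> (ctwo ^c \<mu>) \<or> indecomposable_on Y W \<mu> (ctwo ^c \<mu>)"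
proof (cases "|X| <o \<mu>")
  case True
  then show ?thesis using indecomposable_on_large by blast
next
  case False
  then have "\<mu> \<le>o |X|"
    using \<mu> by (simp add: not_ordLess_iff_ordLeq card_of_Well_order card_order_on_well_order_on)
  then have "|Field \<mu>| \<le>o |X|"
    using \<mu> card_of_Field_ordIso ordIso_ordLeq_trans by blast
  then obtain f where f: "inj_on f (Field \<mu>)" "f ` Field \<mu> \<subseteq> X"
    unfolding card_of_ordLeq[symmetric] by blast
  define \<kappa> :: "('a + 'b) rel" where "\<kappa> = |(Inl \<circ> f) ` Field \<mu>|"
  have inj: "inj_on (Inl \<circ> f :: _ \<Rightarrow> 'a + 'b) (Field \<mu>)"
    using f(1) by (simp add: inj_on_def)
  then have "|Field \<mu>| =o \<kappa>"
    unfolding \<kappa>_def using card_of_ordIsoI inj_on_imp_bij_betw by blast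
  then have iso: "\<kappa> =o \<mu>"
    using \<mu> card_of_Field_ordIso ordIso_symmetric ordIso_transitive by blast
  have inf: "Cinfinite \<kappa>"
    using Cinfinite_cong[OF ordIso_symmetric[OF iso] \<mu>] .
  have pow: "ctwo ^c \<kappa> =o ctwo ^c \<mu>"
    using iso inf \<mu> by (intro cexp_cong2) (auto simp: Card_order_ctwo)
  show ?thesis
    using all[OF inf] indecomposable_on_cong[OF _ iso pow, of X U]
      indecomposable_on_cong[OF _ iso pow, of Y W] by satx
qed

end

theory Submission
  imports Defs
begin

text \<open>
  A relation \<open>R\<close> cuts \<open>A \<times> B\<close> into rows \<open>{y \<in> B. R x y}\<close> for \<open>x \<in> A\<close>, and columns. Among all
  \<open>A \<in> U\<close>, \<open>B \<in> W\<close>, take the least number \<open>\<lambda>\<close> of distinct rows or of distinct columns; by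
  symmetry it is the number of rows of some \<open>A \<times> B\<close>. If \<open>\<lambda>\<close> were infinite, then \<open>U\<close> would not be
  \<open>(\<lambda>, 2\<^sup>\<lambda>)\<close>-indecomposable, since shrinking \<open>A\<close> cannot lower the number of rows. So \<open>W\<close> is, and
  as there are at most \<open>2\<^sup>\<lambda>\<close> columns, shrinking \<open>B\<close> leaves fewer than \<open>\<lambda>\<close> of them, contradicting
  minimality. Hence \<open>\<lambda>\<close> is finite, so \<open>A\<close> shrinks to a set in \<open>U\<close> all of whose rows are the same
  \<open>C\<close>, and either \<open>C\<close> or \<open>B - C\<close> lies in \<open>W\<close>.
\<close>

definition large :: "'a set \<Rightarrow> 'a filter \<Rightarrow> 'a set set" where
  "large X U = {A. A \<subseteq> X \<and> eventually (\<lambda>x. x \<in> A) U}"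

text \<open>Columns are the rows of the converse relation,
  \<open>traces R\<inverse>\<inverse> B A\<close>, so one notion serves both sides.\<close>

definition traces :: "('a \<Rightarrow> 'b \<Rightarrow> bool) \<Rightarrow> 'a set \<Rightarrow> 'b set \<Rightarrow> 'b set set" where
  "traces R A B = (\<lambda>x. {y \<in> B. R x y}) ` A"

lemma ultrafilter_onD:
  assumes "ultrafilter_on X U"
  shows "U \<noteq> bot" and "eventually (\<lambda>x. x \<in> X) U"
  using assms unfolding ultrafilter_on_def by - (elim conjE, assumption)+

lemma ultrafilter_on_cases:
  assumes "ultrafilter_on X U"
  shows "eventually P U \<or> eventually (\<lambda>x. \<not> P x) U"
proof -
  have "{x \<in> X. P x} \<subseteq> X"
    by blast
  then have "eventually (\<lambda>x. x \<in> {x \<in> X. P x}) U \<or> eventually (\<lambda>x. x \<in> X - {x \<in> X. P x}) U"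
    using assms unfolding ultrafilter_on_def by metis
  then show ?thesis
    by (rule disj_forward) (erule eventually_mono, simp)+
qed

text \<open>Otherwise each of the finitely many values is avoided on a set in \<open>U\<close>,
  hence all of them at once, which is impossible on \<open>A\<close>.\<close>

lemma ultrafilter_on_finite_image:
  assumes U: "ultrafilter_on X U" and A: "eventually (\<lambda>x. x \<in> A) U" and fin: "finite (f ` A)"
  obtains x where "x \<in> A" "eventually (\<lambda>z. f z = f x) U"
proof -
  have "\<exists>x\<in>A. eventually (\<lambda>z. f z = f x) U"
  proof (rule ccontr)
    assume "\<not> ?thesis"
    then have "eventually (\<lambda>z. f z \<noteq> f x) U" if "x \<in> A" for x
      using ultrafilter_on_cases[OF U, of "\<lambda>z. f z = f x"] that by auto
    then have "\<forall>c\<in>f ` A. eventually (\<lambda>z. f z \<noteq> c) U"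
      by simp
    then have "eventually (\<lambda>z. \<forall>c\<in>f ` A. f z \<noteq> c) U"
      by (rule eventually_ball_finite[OF fin])
    with A have "eventually (\<lambda>z. False) U"
      by eventually_elim (metis imageI)
    then show False
      using ultrafilter_onD(1)[OF U] by simp
  qed
  then show thesis by (rule bexE) (rule that)
qed

text \<open>Indecomposability is applied to the partition of \<open>A\<close> into fibres of
  \<open>f\<close>; \<open>A'\<close> is the union of the fewer than \<open>\<kappa>\<close> fibres
  that it selects.\<close>

lemma indecomposable_on_image:
  assumes ind: "indecomposable_on X U \<kappa> \<eta>" and A: "A \<in> large X U" and le: "|f ` A| \<le>o \<eta>"
  obtains A' where "A' \<in> large X U" "|f ` A'| <o \<kappa>"
proof -
  define P where "P = (\<lambda>c. {x \<in> A. f x = c}) ` f ` A"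
  have "P \<subseteq> Pow X"
    using A unfolding P_def large_def by blast
  moreover have "|P| \<le>o \<eta>"
    unfolding P_def using card_of_image le by (rule ordLeq_transitive)
  moreover have "\<Union>P = A"
    unfolding P_def by blast
  ultimately have "P \<subseteq> Pow X \<and> |P| \<le>o \<eta> \<and> eventually (\<lambda>x. x \<in> \<Union>P) U"
    using A by (simp add: large_def)
  from ind[unfolded indecomposable_on_def, THEN spec, THEN mp, OF this]
  obtain Q where Q: "Q \<subseteq> P" "|Q| <o \<kappa>" "eventually (\<lambda>x. x \<in> \<Union>Q) U"
    by (elim exE conjE)
  \<comment> \<open>Since \<open>f\<close> is constant on each member of \<open>Q\<close>, its value
    at one chosen point per member recovers all its values on \<open>\<Union>Q\<close>.\<close>
  have "f ` \<Union>Q \<subseteq> (\<lambda>q. f (SOME x. x \<in> q)) ` Q"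
  proof
    fix c assume "c \<in> f ` \<Union>Q"
    then obtain q x where q: "q \<in> Q" "x \<in> q" "c = f x" by blast
    have "(SOME x. x \<in> q) \<in> q"
      using q(2) by (rule someI)
    moreover obtain d where "q = {x \<in> A. f x = d}"
      using q(1) Q(1) unfolding P_def by blast
    ultimately have "c = f (SOME x. x \<in> q)"
      using q(2,3) by simp
    then show "c \<in> (\<lambda>q. f (SOME x. x \<in> q)) ` Q"
      using q(1) by (rule image_eqI)
  qed
  then have "|f ` \<Union>Q| \<le>o |Q|"
    by (rule surj_imp_ordLeq)
  then have "|f ` \<Union>Q| <o \<kappa>"
    using Q(2) by (rule ordLeq_ordLess_trans)
  moreover have "\<Union>Q \<subseteq> X"
    using Q(1) \<open>P \<subseteq> Pow X\<close> by blast
  then have "\<Union>Q \<in> large X U"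
    using Q(3) by (simp add: large_def del: Union_iff)
  ultimately show thesis
    using that by simp
qed

lemma card_of_Pow_ordIso_cexp: "|Pow A| =o ctwo ^c |A|"
  unfolding cexp_def ctwo_def by (simp add: card_of_Pow_Func Field_card_of)

text \<open>The column of \<open>y\<close> is determined by the set of rows that contain
  \<open>y\<close>.\<close>

lemma card_traces_conversep_le: "|traces R\<inverse>\<inverse> B A| \<le>o ctwo ^c |traces R A B|"
proof -
  have "traces R\<inverse>\<inverse> B A \<subseteq> (\<lambda>T. {x \<in> A. {y \<in> B. R x y} \<in> T}) ` Pow (traces R A B)"
  proof
    fix c assume "c \<in> traces R\<inverse>\<inverse> B A"
    then obtain y where "y \<in> B" "c = {x \<in> A. R x y}"
      unfolding traces_def by auto
    then have "c = {x \<in> A. {y \<in> B. R x y} \<in> {r \<in> traces R A B. y \<in> r}}"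
      unfolding traces_def by blast
    then show "c \<in> (\<lambda>T. {x \<in> A. {y \<in> B. R x y} \<in> T}) ` Pow (traces R A B)"
      by blast
  qed
  then have "|traces R\<inverse>\<inverse> B A| \<le>o |Pow (traces R A B)|"
    by (rule surj_imp_ordLeq)
  then show ?thesis
    using card_of_Pow_ordIso_cexp by (rule ordLeq_ordIso_trans)
qed

text \<open>This is the contradiction at an infinite minimum. It speaks of a minimum attained by
  rows; swapping the factors and passing to \<open>R\<inverse>\<inverse>\<close> covers one attained
  by columns.\<close>

lemma finite_minimal_traces:
  assumes ind: "Cinfinite |traces R A B| \<Longrightarrow>
      indecomposable_on X U |traces R A B| (ctwo ^c |traces R A B| ) \<or>
      indecomposable_on Y W |traces R A B| (ctwo ^c |traces R A B| )"
    and A: "A \<in> large X U" and B: "B \<in> large Y W"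
    and rows: "\<And>A' B'. A' \<in> large X U \<Longrightarrow> B' \<in> large Y W \<Longrightarrow>
      |traces R A B| \<le>o |traces R A' B'|"
    and cols: "\<And>A' B'. A' \<in> large X U \<Longrightarrow> B' \<in> large Y W \<Longrightarrow>
      |traces R A B| \<le>o |traces R\<inverse>\<inverse> B' A'|"
  shows "finite (traces R A B)"
proof (rule ccontr)
  let ?\<kappa> = "|traces R A B|"
  assume "infinite (traces R A B)"
  then have "Cinfinite ?\<kappa>"
    by (simp add: cinfinite_def Field_card_of card_of_card_order_on)
  with ind consider "indecomposable_on X U ?\<kappa> (ctwo ^c ?\<kappa>)"
    | "indecomposable_on Y W ?\<kappa> (ctwo ^c ?\<kappa>)" by blast
  then show False
  proof cases
    case 1
    have "?\<kappa> \<le>o ctwo ^c ?\<kappa>"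
      using card_of_Pow card_of_Pow_ordIso_cexp
      by (rule ordLess_imp_ordLeq[OF ordLess_ordIso_trans])
    with 1 A obtain A' where A': "A' \<in> large X U" "|traces R A' B| <o ?\<kappa>"
      unfolding traces_def by (rule indecomposable_on_image)
    then show False
      using rows[OF A'(1) B] not_ordLess_ordLeq by blast
  next
    case 2
    \<comment> \<open>The exponential bound enters here: the columns of \<open>A \<times> B\<close>
      may outnumber its \<open>?\<kappa>\<close> rows.\<close>
    note le = card_traces_conversep_le[of R B A]
    obtain B' where B': "B' \<in> large Y W" "|traces R\<inverse>\<inverse> B' A| <o ?\<kappa>"
      using indecomposable_on_image[OF 2 B le[unfolded traces_def[of "R\<inverse>\<inverse>"]]]
      unfolding traces_def[of "R\<inverse>\<inverse>"] by blast
    then show False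
      using cols[OF A B'(1)] not_ordLess_ordLeq by blast
  qed
qed

lemma finite_traces_homogeneous:
  assumes U: "ultrafilter_on X U" and W: "ultrafilter_on Y W"
    and A: "A \<in> large X U" and B: "B \<in> large Y W"
    and fin: "finite (traces R A B)"
  obtains P Q where "eventually P U" "eventually Q W"
    "(\<forall>x y. P x \<longrightarrow> Q y \<longrightarrow> R x y) \<or> (\<forall>x y. P x \<longrightarrow> Q y \<longrightarrow> \<not> R x y)"
proof -
  have evA: "eventually (\<lambda>x. x \<in> A) U"
    using A by (simp add: large_def)
  obtain x where x: "eventually (\<lambda>z. {y \<in> B. R z y} = {y \<in> B. R x y}) U"
    by (rule ultrafilter_on_finite_image[OF U evA fin[unfolded traces_def]])
  have evB: "eventually (\<lambda>y. y \<in> B) W"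
    using B by (simp add: large_def)
  from ultrafilter_on_cases[OF W, of "R x"] show thesis
  proof
    assume "eventually (R x) W"
    \<comment> \<open>Equal rows give information about \<open>R\<close> only on \<open>B\<close>,
      hence the conjunct \<open>y \<in> B\<close>.\<close>
    with evB have "eventually (\<lambda>y. y \<in> B \<and> R x y) W"
      by (rule eventually_conj)
    with x show thesis by (rule that) blast
  next
    assume "eventually (\<lambda>y. \<not> R x y) W"
    with evB have "eventually (\<lambda>y. y \<in> B \<and> \<not> R x y) W"
      by (rule eventually_conj)
    with x show thesis by (rule that) blast
  qed
qed

lemma ex_minimal_card_of:
  assumes "S \<noteq> {}"
  shows "\<exists>i\<in>S. \<forall>j\<in>S. |f i| \<le>o |f j|"
  using exists_minim_Well_order[of "(\<lambda>i. |f i| ) ` S"] assms card_of_Well_order by blast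

text \<open>Since rectangles generate the product filter, deciding an arbitrary relation on a
  rectangle is what its ultrafilter property amounts to.\<close>

lemma homogeneous_rectangle:
  fixes X :: "'a set" and Y :: "'b set"
  assumes U: "ultrafilter_on X U" and W: "ultrafilter_on Y W"
    and ind: "\<And>\<kappa> :: ('a + 'b) rel. Cinfinite \<kappa> \<Longrightarrow>
      indecomposable_on X U \<kappa> (ctwo ^c \<kappa>) \<or> indecomposable_on Y W \<kappa> (ctwo ^c \<kappa>)"
  obtains P Q where "eventually P U" "eventually Q W"
    "(\<forall>x y. P x \<longrightarrow> Q y \<longrightarrow> R x y) \<or> (\<forall>x y. P x \<longrightarrow> Q y \<longrightarrow> \<not> R x y)"
proof -
  define S where "S = large X U \<times> large Y W"
  have "(X, Y) \<in> S"
    using ultrafilter_onD(2)[OF U] ultrafilter_onD(2)[OF W] by (simp add: S_def large_def)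
  then have S: "S \<noteq> {}" by blast
  \<comment> \<open>Rows and columns are sets over different types, so the two minima are taken
    separately, possibly at different rectangles, and compared afterwards.\<close>
  obtain p where p: "p \<in> S"
    "\<forall>q\<in>S. |traces R (fst p) (snd p)| \<le>o |traces R (fst q) (snd q)|"
    by (rule bexE[OF ex_minimal_card_of[OF S, of "\<lambda>p. traces R (fst p) (snd p)"]])
  obtain q where q: "q \<in> S"
    "\<forall>p\<in>S. |traces R\<inverse>\<inverse> (snd q) (fst q)| \<le>o |traces R\<inverse>\<inverse> (snd p) (fst p)|"
    by (rule bexE[OF ex_minimal_card_of[OF S, of "\<lambda>p. traces R\<inverse>\<inverse> (snd p) (fst p)"]])
  obtain A B where AB: "p = (A, B)" by (cases p)
  obtain C D where CD: "q = (C, D)" by (cases q)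
  have A: "A \<in> large X U" "B \<in> large Y W" and C: "C \<in> large X U" "D \<in> large Y W"
    using p(1) q(1) AB CD by (auto simp: S_def)
  have rows: "|traces R A B| \<le>o |traces R A' B'|"
    and cols: "|traces R\<inverse>\<inverse> D C| \<le>o |traces R\<inverse>\<inverse> B' A'|"
    if "A' \<in> large X U" "B' \<in> large Y W" for A' B'
    using p(2)[THEN bspec, of "(A', B')"] q(2)[THEN bspec, of "(A', B')"] that AB CD
    by (simp_all add: S_def)
  consider "|traces R A B| \<le>o |traces R\<inverse>\<inverse> D C|" | "|traces R\<inverse>\<inverse> D C| \<le>o |traces R A B|"
    by (rule disjE[OF ordLeq_total[OF card_of_Well_order card_of_Well_order]])
  then show thesis
  proof cases
    case 1
    have "finite (traces R A B)"
    proof (rule finite_minimal_traces[OF _ A])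
      \<comment> \<open>This cardinal lives on \<open>'b set\<close>, whereas \<open>ind\<close>
        covers cardinals on \<open>'a + 'b\<close>; hence the transfer between types.\<close>
      assume "Cinfinite |traces R A B|"
      with ind show "indecomposable_on X U |traces R A B| (ctwo ^c |traces R A B| ) \<or>
          indecomposable_on Y W |traces R A B| (ctwo ^c |traces R A B| )"
        by (rule indecomposable_all_cardinals)
    next
      show "|traces R A B| \<le>o |traces R\<inverse>\<inverse> B' A'|"
        if "A' \<in> large X U" "B' \<in> large Y W" for A' B'
        using 1 cols[OF that] by (rule ordLeq_transitive)
    qed (rule rows)
    then show thesis
      by (rule finite_traces_homogeneous[OF U W A]) (rule that)
  next
    case 2
    \<comment> \<open>The same argument with the factors exchanged; the double converse in its
      column condition is \<open>R\<close> again.\<close>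
    have "finite (traces R\<inverse>\<inverse> D C)"
    proof (rule finite_minimal_traces[OF _ C(2,1)])
      show "|traces R\<inverse>\<inverse> D C| \<le>o |traces R\<inverse>\<inverse>\<inverse>\<inverse> A' B'|"
        if "B' \<in> large Y W" "A' \<in> large X U" for A' B'
        using ordLeq_transitive[OF 2 rows[OF that(2,1)]] by simp
    next
      assume "Cinfinite |traces R\<inverse>\<inverse> D C|"
      with ind have "indecomposable_on X U |traces R\<inverse>\<inverse> D C| (ctwo ^c |traces R\<inverse>\<inverse> D C| ) \<or>
          indecomposable_on Y W |traces R\<inverse>\<inverse> D C| (ctwo ^c |traces R\<inverse>\<inverse> D C| )"
        by (rule indecomposable_all_cardinals)
      then show "indecomposable_on Y W |traces R\<inverse>\<inverse> D C| (ctwo ^c |traces R\<inverse>\<inverse> D C| ) \<or>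
          indecomposable_on X U |traces R\<inverse>\<inverse> D C| (ctwo ^c |traces R\<inverse>\<inverse> D C| )"
        by (rule disj_commute[THEN iffD1])
    qed (rule cols)
    then obtain Q P where "eventually Q W" "eventually P U"
      "(\<forall>y x. Q y \<longrightarrow> P x \<longrightarrow> R\<inverse>\<inverse> y x) \<or> (\<forall>y x. Q y \<longrightarrow> P x \<longrightarrow> \<not> R\<inverse>\<inverse> y x)"
      by (rule finite_traces_homogeneous[OF W U C(2,1)])
    then show thesis
      by (intro that[of P Q]) auto
  qed
qed

theorem theorem2p14:
  fixes X :: "'a set" and Y :: "'b set"
    and U :: "'a filter" and W :: "'b filter"
  assumes "ultrafilter_on X U" and "ultrafilter_on Y W"
    and "\<And>\<kappa> :: ('a + 'b) rel. Cinfinite \<kappa> \<Longrightarrow>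
           indecomposable_on X U \<kappa> (ctwo ^c \<kappa>) \<or> indecomposable_on Y W \<kappa> (ctwo ^c \<kappa>)"
  shows "ultrafilter_on (X \<times> Y) (U \<times>\<^sub>F W)"
proof -
  have "U \<times>\<^sub>F W \<noteq> bot"
    using ultrafilter_onD(1)[OF assms(1)] ultrafilter_onD(1)[OF assms(2)]
    by (simp add: prod_filter_eq_bot)
  moreover have XY: "eventually (\<lambda>z. z \<in> X \<times> Y) (U \<times>\<^sub>F W)"
    using ultrafilter_onD(2)[OF assms(1)] ultrafilter_onD(2)[OF assms(2)]
    unfolding eventually_prod_filter by blast
  moreover have "eventually (\<lambda>z. z \<in> S) (U \<times>\<^sub>F W) \<or> eventually (\<lambda>z. z \<in> X \<times> Y - S) (U \<times>\<^sub>F W)"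
    for S
  proof -
    \<comment> \<open>A rectangle inside \<open>S\<close> or disjoint from \<open>S\<close> settles
      which of \<open>S\<close> and its complement belongs to the product filter.\<close>
    obtain P Q where "eventually P U" "eventually Q W"
      "(\<forall>x y. P x \<longrightarrow> Q y \<longrightarrow> (x, y) \<in> S) \<or> (\<forall>x y. P x \<longrightarrow> Q y \<longrightarrow> (x, y) \<notin> S)"
      using homogeneous_rectangle[OF assms, of "\<lambda>x y. (x, y) \<in> S"] by blast
    then have "eventually (\<lambda>z. z \<in> S) (U \<times>\<^sub>F W) \<or> eventually (\<lambda>z. z \<notin> S) (U \<times>\<^sub>F W)"
      unfolding eventually_prod_filter by blast
    then show ?thesis
      using XY by (simp add: eventually_conj_iff del: mem_Times_iff)
  qed
  ultimately show ?thesis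
    by (intro ultrafilter_on_def[THEN iffD2] conjI allI impI)
qed

end
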